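(* Let $\mathcal{L}\in\mathcal{M}(N)$, $\mathcal{T}\in\mathcal{A}(N)$, let $\mathbb{A}$ abstract $(\mathcal{L},\mathcal{T})$, and let $(\mathcal{T},\mathbb{A})\models\mathsf{AxCmpl}$ with witness function $t_{cnv}$. For every trace $s\in\mathsf{Act}^*$ and every state $p$ of $\mathcal{L}$: Must$(p,t_{cnv}(\overline{s}))$ if and only if $p\Downarrow s$, where $\overline{s}$ is $s$ with every action replaced by its dual.
   Context: Same setting as follows. $\mathsf{Act}$ countable set of visible actions, $\tau\notin\mathsf{Act}$, $\mathsf{L}=\mathsf{Act}\cup\{\tau\}$, involutive duality $\mu\mapsto\overline{\mu}$; $N\subseteq\mathsf{Act}$ non-blocking, $B=\mathsf{Act}\setminus N$; LTSs finite-image. Axioms (all $\alpha\in\mathsf{L}$, $\eta\in N$, $\mu\in\mathsf{Act}$, $\mu\ne\eta$): N-delay: $p_1\xrightarrow{\eta}p_2\xrightarrow{\alpha}p_3\Rightarrow\exists p_4.\,p_1\xrightarrow{\alpha}p_4\xrightarrow{\eta}p_3$; N-confluence: $p_1\xrightarrow{\eta}p_2,p_1\xrightarrow{\mu}p_3\Rightarrow\exists p_4.\,p_2\xrightarrow{\mu}p_4,p_3\xrightarrow{\eta}p_4$; N-determinacy: $p_1\xrightarrow{\eta}p_2,p_1\xrightarrow{\eta}p_3\Rightarrow p_2=p_3$; backwards-N-determinacy: $p_2\xrightarrow{\eta}p_1,p_3\xrightarrow{\eta}p_1\Rightarrow p_2=p_3$; Fwd-Feedback: $p_1\xrightarrow{\eta}p_2\xrightarrow{\overline{\eta}}p_3\Rightarrow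 p_1\xrightarrow{\tau}p_3$ or $p_1=p_3$; Boomerang: each $p$ has $p'$ with $p\xrightarrow{\overline{\eta}}p'\xrightarrow{\eta}p$; N-tau: $p_1\xrightarrow{\eta}p_2,p_1\xrightarrow{\tau}p_3$ imply $\exists p_4.\,p_2\xrightarrow{\tau}p_4,p_3\xrightarrow{\eta}p_4$, or $p_2\xrightarrow{\overline{\eta}}p_3$; Feedback: $p\xrightarrow{\eta}q\xrightarrow{\overline{\eta}}q'\Rightarrow p\xrightarrow{\tau}q'$. $\mathcal{M}(N)$: LTSs with N-delay, N-confluence, N-determinacy, backwards-N-determinacy, Fwd-Feedback, Boomerang, N-tau. $\mathcal{A}(N)$: LTSs with N-delay, N-confluence, N-determinacy, backwards-N-determinacy, N-tau, Feedback. Composition of $p$ and test $t$ steps by $\tau$-moves of either side or by $p\xrightarrow{\overline{\mu}}p'$, $t\xrightarrow{\mu}t'$. good: decidable predicate on tests preserved in both directions by $N$-transitions. Must$(p,t)$ iff every maximal computation from $(p,t)$ contains a state with good test. $p\Downarrow s$: no state reached via a weak transition along a prefix of $s$ has an infinite $\tau$-sequence. $R(t)=\{\mu:t\xrightarrow{\mu}\}$, $\mathrm{coR}(p)=\{\beta\in B:p\xrightarrow{\overline{\beta}}\}$. Label abstraction $\mathbb{A}=(\phi:B\to Y,\delta:Y\to X)$; abstracts $(\mathcal{L},\mathcal{T})$ if for all $\beta,\beta'\in B$: (i) for each test $t$, $\phi(\beta)=\phi(\beta')$, $\beta\in R(t)$ imply $\beta'\in R(t)$; (ii) for each $p$ of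 $\mathcal{L}$, $\delta(\phi(\beta))=\delta(\phi(\beta'))$, $\phi(\beta)\in\phi(\mathrm{coR}(p))$ imply $\phi(\beta')\in\phi(\mathrm{coR}(p))$. $(\mathcal{T},\mathbb{A})\models\mathsf{AxCmpl}$: there are $t_{cnv}:\mathsf{Act}^*\to T$, $t_{acc}:\mathsf{Act}^*\times\mathcal{P}_{fin}(X)\to T$ such that for all $s$, $\mu,\mu'\in\mathsf{Act}$, finite $E\subseteq X$, $f\in\{t_{cnv},t_{acc}(\cdot,E)\}$: (1) not good$(f(s))$; (2) $f(\mu.s)\xrightarrow{\mu}f(s)$; (3) $\mu\in B\Rightarrow f(\mu.s)\xrightarrow{\tau}$; (4) $\mu\in B$, $f(\mu.s)\xrightarrow{\tau}t\Rightarrow$ good$(t)$; (5) $\mu\in B$, $f(\mu.s)\xrightarrow{\mu}t\Rightarrow t=f(s)$; (6) $\mu\in B$, $f(\mu.s)\xrightarrow{\mu'}t$, $\mu'\ne\mu\Rightarrow$ good$(t)$; (a1) $t_{acc}(\varepsilon,E)\not\xrightarrow{\tau}$; (a2) $t_{acc}(\varepsilon,E)\not\xrightarrow{\eta}$ for $\eta\in N$; (a3) $\beta\in B$, $t_{acc}(\varepsilon,E)\xrightarrow{\beta}\Rightarrow\delta(\phi(\beta))\in E$; (a4) each $e\in E$ is $\delta(\phi(\beta))$ for some $\beta\in B$ with $t_{acc}(\varepsilon,E)\xrightarrow{\beta}$; (a5) $\beta\in B$, $t_{acc}(\varepsilon,E)\xrightarrow{\beta}t\Rightarrow$ good$(t)$;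 (c1) $t_{cnv}(\varepsilon)\not\xrightarrow{\mu}$ for all $\mu\in\mathsf{Act}$; (c2) $t_{cnv}(\varepsilon)\xrightarrow{\tau}$; (c3) $t_{cnv}(\varepsilon)\xrightarrow{\tau}t\Rightarrow$ good$(t)$. *)

theory Defs
  imports
    "HOL-Library.Countable"
    "HOL-Library.Extended_Nat"
    "HOL-Library.FuncSet"
    "HOL-Library.Sublist"
begin

text \<open>
  The set of visible actions is the universe of the type \<open>'a\<close>. The duality on visible actions is
  the parameter \<open>dual\<close>, the non-blocking actions are the parameter \<open>N\<close>, and the blocking
  actions \<open>B\<close> are \<open>- N\<close>.
\<close>

datatype 'a label = Vis 'a | Tau

type_synonym ('s, 'a) lts = "'s \<Rightarrow> 'a label \<Rightarrow> 's \<Rightarrow> bool"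

definition involutive :: "('a \<Rightarrow> 'a) \<Rightarrow> bool" where
  "involutive dual \<longleftrightarrow> (\<forall>\<mu>. dual (dual \<mu>) = \<mu>)"

definition finite_image :: "('s, 'a) lts \<Rightarrow> bool" where
  "finite_image L \<longleftrightarrow> (\<forall>p \<alpha>. finite {q. L p \<alpha> q})"

definition N_delay :: "'a set \<Rightarrow> ('s, 'a) lts \<Rightarrow> bool" where
  "N_delay N L \<longleftrightarrow> (\<forall>\<eta>\<in>N. \<forall>\<alpha> p1 p2 p3.
     L p1 (Vis \<eta>) p2 \<longrightarrow> L p2 \<alpha> p3 \<longrightarrow> (\<exists>p4. L p1 \<alpha> p4 \<and> L p4 (Vis \<eta>) p3))"

definition N_confluence :: "'a set \<Rightarrow> ('s, 'a) lts \<Rightarrow> bool" where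
  "N_confluence N L \<longleftrightarrow> (\<forall>\<eta>\<in>N. \<forall>\<mu> p1 p2 p3. \<mu> \<noteq> \<eta> \<longrightarrow>
     L p1 (Vis \<eta>) p2 \<longrightarrow> L p1 (Vis \<mu>) p3 \<longrightarrow> (\<exists>p4. L p2 (Vis \<mu>) p4 \<and> L p3 (Vis \<eta>) p4))"

definition N_determinacy :: "'a set \<Rightarrow> ('s, 'a) lts \<Rightarrow> bool" where
  "N_determinacy N L \<longleftrightarrow> (\<forall>\<eta>\<in>N. \<forall>p1 p2 p3.
     L p1 (Vis \<eta>) p2 \<longrightarrow> L p1 (Vis \<eta>) p3 \<longrightarrow> p2 = p3)"

definition backwards_N_determinacy :: "'a set \<Rightarrow> ('s, 'a) lts \<Rightarrow> bool" where
  "backwards_N_determinacy N L \<longleftrightarrow> (\<forall>\<eta>\<in>N. \<forall>p1 p2 p3.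
     L p2 (Vis \<eta>) p1 \<longrightarrow> L p3 (Vis \<eta>) p1 \<longrightarrow> p2 = p3)"

definition Fwd_Feedback :: "('a \<Rightarrow> 'a) \<Rightarrow> 'a set \<Rightarrow> ('s, 'a) lts \<Rightarrow> bool" where
  "Fwd_Feedback dual N L \<longleftrightarrow> (\<forall>\<eta>\<in>N. \<forall>p1 p2 p3.
     L p1 (Vis \<eta>) p2 \<longrightarrow> L p2 (Vis (dual \<eta>)) p3 \<longrightarrow> L p1 Tau p3 \<or> p1 = p3)"

definition Boomerang :: "('a \<Rightarrow> 'a) \<Rightarrow> 'a set \<Rightarrow> ('s, 'a) lts \<Rightarrow> bool" where
  "Boomerang dual N L \<longleftrightarrow> (\<forall>\<eta>\<in>N. \<forall>p. \<exists>p'. L p (Vis (dual \<eta>)) p' \<and> L p' (Vis \<eta>) p)"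

definition N_tau :: "('a \<Rightarrow> 'a) \<Rightarrow> 'a set \<Rightarrow> ('s, 'a) lts \<Rightarrow> bool" where
  "N_tau dual N L \<longleftrightarrow> (\<forall>\<eta>\<in>N. \<forall>p1 p2 p3.
     L p1 (Vis \<eta>) p2 \<longrightarrow> L p1 Tau p3 \<longrightarrow>
     (\<exists>p4. L p2 Tau p4 \<and> L p3 (Vis \<eta>) p4) \<or> L p2 (Vis (dual \<eta>)) p3)"

definition Feedback :: "('a \<Rightarrow> 'a) \<Rightarrow> 'a set \<Rightarrow> ('s, 'a) lts \<Rightarrow> bool" where
  "Feedback dual N L \<longleftrightarrow> (\<forall>\<eta>\<in>N. \<forall>p q q'.
     L p (Vis \<eta>) q \<longrightarrow> L q (Vis (dual \<eta>)) q' \<longrightarrow> L p Tau q')"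

definition class_M :: "('a \<Rightarrow> 'a) \<Rightarrow> 'a set \<Rightarrow> ('s, 'a) lts set" where
  "class_M dual N = {L. finite_image L \<and> N_delay N L \<and> N_confluence N L \<and> N_determinacy N L \<and>
     backwards_N_determinacy N L \<and> Fwd_Feedback dual N L \<and> Boomerang dual N L \<and> N_tau dual N L}"

definition class_A :: "('a \<Rightarrow> 'a) \<Rightarrow> 'a set \<Rightarrow> ('s, 'a) lts set" where
  "class_A dual N = {L. finite_image L \<and> N_delay N L \<and> N_confluence N L \<and> N_determinacy N L \<and>
     backwards_N_determinacy N L \<and> N_tau dual N L \<and> Feedback dual N L}"

definition good_predicate :: "'a set \<Rightarrow> ('t, 'a) lts \<Rightarrow> ('t \<Rightarrow> bool) \<Rightarrow> bool" where
  "good_predicate N T good \<longleftrightarrow> (\<forall>\<eta>\<in>N. \<forall>t t'. T t (Vis \<eta>) t' \<longrightarrow> (good t \<longleftrightarrow> good t'))"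

inductive comp_step ::
  "('a \<Rightarrow> 'a) \<Rightarrow> ('p, 'a) lts \<Rightarrow> ('t, 'a) lts \<Rightarrow> 'p \<times> 't \<Rightarrow> 'p \<times> 't \<Rightarrow> bool"
  for dual L T where
  proc: "L p Tau p' \<Longrightarrow> comp_step dual L T (p, t) (p', t)"
| test: "T t Tau t' \<Longrightarrow> comp_step dual L T (p, t) (p, t')"
| comm: "L p (Vis (dual \<mu>)) p' \<Longrightarrow> T t (Vis \<mu>) t' \<Longrightarrow> comp_step dual L T (p, t) (p', t')"

text \<open>
  A computation is given by its states \<open>c 0, c 1, \<dots>\<close> and its number \<open>n\<close> of steps, which
  may be infinite; the values \<open>c i\<close> with \<open>i > n\<close> are irrelevant.
\<close>

definition maximal_computation :: "('c \<Rightarrow> 'c \<Rightarrow> bool) \<Rightarrow> 'c \<Rightarrow> (nat \<Rightarrow> 'c) \<Rightarrow> enat \<Rightarrow> bool" where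
  "maximal_computation step x c n \<longleftrightarrow>
     c 0 = x \<and>
     (\<forall>i. enat i < n \<longrightarrow> step (c i) (c (Suc i))) \<and>
     (\<forall>m. n = enat m \<longrightarrow> (\<nexists>y. step (c m) y))"

definition Must ::
  "('a \<Rightarrow> 'a) \<Rightarrow> ('p, 'a) lts \<Rightarrow> ('t, 'a) lts \<Rightarrow> ('t \<Rightarrow> bool) \<Rightarrow> 'p \<Rightarrow> 't \<Rightarrow> bool" where
  "Must dual L T good p t \<longleftrightarrow>
     (\<forall>c n. maximal_computation (comp_step dual L T) (p, t) c n \<longrightarrow>
        (\<exists>i. enat i \<le> n \<and> good (snd (c i))))"

inductive weak :: "('s, 'a) lts \<Rightarrow> 's \<Rightarrow> 'a list \<Rightarrow> 's \<Rightarrow> bool" for L where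
  refl: "weak L p [] p"
| tau: "L p Tau p' \<Longrightarrow> weak L p' s q \<Longrightarrow> weak L p s q"
| vis: "L p (Vis \<mu>) p' \<Longrightarrow> weak L p' s q \<Longrightarrow> weak L p (\<mu> # s) q"

definition diverges :: "('s, 'a) lts \<Rightarrow> 's \<Rightarrow> bool" where
  "diverges L p \<longleftrightarrow> (\<exists>f :: nat \<Rightarrow> 's. f 0 = p \<and> (\<forall>i. L (f i) Tau (f (Suc i))))"

definition converges_along :: "('s, 'a) lts \<Rightarrow> 's \<Rightarrow> 'a list \<Rightarrow> bool" where
  "converges_along L p s \<longleftrightarrow> (\<forall>u q. prefix u s \<longrightarrow> weak L p u q \<longrightarrow> \<not> diverges L q)"

definition ready :: "('t, 'a) lts \<Rightarrow> 't \<Rightarrow> 'a set" where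
  "ready T t = {\<mu>. \<exists>t'. T t (Vis \<mu>) t'}"

definition coready :: "('a \<Rightarrow> 'a) \<Rightarrow> 'a set \<Rightarrow> ('p, 'a) lts \<Rightarrow> 'p \<Rightarrow> 'a set" where
  "coready dual N L p = {\<beta> \<in> - N. \<exists>p'. L p (Vis (dual \<beta>)) p'}"

text \<open>
  The codomains of a label abstraction are carrier sets rather than types: they may be empty when
  there are no blocking actions.
\<close>

definition label_abstraction ::
  "'a set \<Rightarrow> 'y set \<Rightarrow> 'x set \<Rightarrow> ('a \<Rightarrow> 'y) \<Rightarrow> ('y \<Rightarrow> 'x) \<Rightarrow> bool" where
  "label_abstraction N Y X \<phi> \<delta> \<longleftrightarrow> \<phi> \<in> - N \<rightarrow> Y \<and> \<delta> \<in> Y \<rightarrow> X"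

definition abstracts ::
  "('a \<Rightarrow> 'a) \<Rightarrow> 'a set \<Rightarrow> ('a \<Rightarrow> 'y) \<Rightarrow> ('y \<Rightarrow> 'x) \<Rightarrow> ('p, 'a) lts \<Rightarrow> ('t, 'a) lts \<Rightarrow> bool" where
  "abstracts dual N \<phi> \<delta> L T \<longleftrightarrow> (\<forall>\<beta>\<in>- N. \<forall>\<beta>'\<in>- N.
     (\<forall>t. \<phi> \<beta> = \<phi> \<beta>' \<longrightarrow> \<beta> \<in> ready T t \<longrightarrow> \<beta>' \<in> ready T t) \<and>
     (\<forall>p. \<delta> (\<phi> \<beta>) = \<delta> (\<phi> \<beta>') \<longrightarrow> \<phi> \<beta> \<in> \<phi> ` coready dual N L p \<longrightarrow>
        \<phi> \<beta>' \<in> \<phi> ` coready dual N L p))"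

definition trace_tests ::
  "'a set \<Rightarrow> ('t, 'a) lts \<Rightarrow> ('t \<Rightarrow> bool) \<Rightarrow> ('a list \<Rightarrow> 't) \<Rightarrow> bool" where
  "trace_tests N T good f \<longleftrightarrow> (\<forall>s \<mu>.
     \<not> good (f s) \<and>
     T (f (\<mu> # s)) (Vis \<mu>) (f s) \<and>
     (\<mu> \<in> - N \<longrightarrow>
        (\<exists>t. T (f (\<mu> # s)) Tau t) \<and>
        (\<forall>t. T (f (\<mu> # s)) Tau t \<longrightarrow> good t) \<and>
        (\<forall>t. T (f (\<mu> # s)) (Vis \<mu>) t \<longrightarrow> t = f s) \<and>
        (\<forall>\<mu>' t. T (f (\<mu> # s)) (Vis \<mu>') t \<longrightarrow> \<mu>' \<noteq> \<mu> \<longrightarrow> good t)))"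

definition AxCmpl_witness ::
  "'a set \<Rightarrow> ('t, 'a) lts \<Rightarrow> ('t \<Rightarrow> bool) \<Rightarrow> 'x set \<Rightarrow> ('a \<Rightarrow> 'y) \<Rightarrow> ('y \<Rightarrow> 'x) \<Rightarrow>
   ('a list \<Rightarrow> 't) \<Rightarrow> ('a list \<Rightarrow> 'x set \<Rightarrow> 't) \<Rightarrow> bool" where
  "AxCmpl_witness N T good X \<phi> \<delta> t_cnv t_acc \<longleftrightarrow>
     trace_tests N T good t_cnv \<and>
     (\<forall>E. finite E \<longrightarrow> E \<subseteq> X \<longrightarrow>
        trace_tests N T good (\<lambda>s. t_acc s E) \<and>
        (\<nexists>t. T (t_acc [] E) Tau t) \<and>
        (\<forall>\<eta>\<in>N. \<nexists>t. T (t_acc [] E) (Vis \<eta>) t) \<and>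
        (\<forall>\<beta>\<in>- N. (\<exists>t. T (t_acc [] E) (Vis \<beta>) t) \<longrightarrow> \<delta> (\<phi> \<beta>) \<in> E) \<and>
        (\<forall>e\<in>E. \<exists>\<beta>\<in>- N. e = \<delta> (\<phi> \<beta>) \<and> (\<exists>t. T (t_acc [] E) (Vis \<beta>) t)) \<and>
        (\<forall>\<beta>\<in>- N. \<forall>t. T (t_acc [] E) (Vis \<beta>) t \<longrightarrow> good t)) \<and>
     (\<forall>\<mu>. \<nexists>t. T (t_cnv []) (Vis \<mu>) t) \<and>
     (\<exists>t. T (t_cnv []) Tau t) \<and>
     (\<forall>t. T (t_cnv []) Tau t \<longrightarrow> good t)"

end

theory Submission imports Defs begin

text \<open>
  If \<open>p\<close> fails to converge along \<open>s\<close>, then the test follows \<open>p\<close> along a prefix of \<open>s\<close> without ever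
  becoming good, and \<open>p\<close> diverges there. Conversely, replace \<open>Must\<close> by the least fixed point
  \<open>inevitable\<close> and use induction on \<open>s\<close>. At a blocking action the test offers only success or the
  expected step, and the internal steps of \<open>p\<close> are well-founded. At a non-blocking action \<open>\<eta>\<close> the
  behaviour of the test is not controlled; instead, Boomerang gives \<open>p'\<close> with
  \<open>p \<midarrow>dual \<eta>\<rightarrow> p' \<midarrow>\<eta>\<rightarrow> p\<close>, and the outcome does not depend on whether the process or the test holds
  the pending \<open>\<eta>\<close>.
\<close>

section \<open>Inevitability and maximal computations\<close>

text \<open>The existence premise of \<open>later\<close> rules out deadlock: otherwise a stuck
  state that violates \<open>P\<close> would be inevitable vacuously.\<close>

inductive inevitable :: "('c \<Rightarrow> 'c \<Rightarrow> bool) \<Rightarrow> ('c \<Rightarrow> bool) \<Rightarrow> 'c \<Rightarrow> bool" for step P where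
  now: "P x \<Longrightarrow> inevitable step P x"
| later: "\<exists>y. step x y \<Longrightarrow> (\<And>y. step x y \<Longrightarrow> inevitable step P y) \<Longrightarrow> inevitable step P x"

lemma maximal_computation_tail:
  assumes "maximal_computation step x c n" and "n \<noteq> 0"
  obtains m where "n = eSuc m" and "step x (c 1)"
    and "maximal_computation step (c 1) (\<lambda>i. c (Suc i)) m"
proof -
  obtain m where m: "n = eSuc m"
    using assms(2) by (metis eSuc_enat eSuc_infinity enat.exhaust not0_implies_Suc zero_enat_def)
  have "step x (c 1)"
    using assms m unfolding maximal_computation_def
    by (metis One_nat_def i0_less zero_enat_def)
  moreover have "maximal_computation step (c 1) (\<lambda>i. c (Suc i)) m"
    using assms(1) unfolding maximal_computation_def m
    by (metis One_nat_def eSuc_enat eSuc_mono)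
  ultimately show thesis
    using that m by blast
qed

lemma maximal_computation_Cons:
  assumes "step x y" and "maximal_computation step y c n"
  shows "maximal_computation step x (case_nat x c) (eSuc n)"
  unfolding maximal_computation_def
proof (intro conjI allI impI)
  fix i assume "enat i < eSuc n"
  then show "step (case_nat x c i) (case_nat x c (Suc i))"
    using assms unfolding maximal_computation_def
    by (cases i) (auto simp flip: eSuc_enat)
next
  fix m assume "eSuc n = enat m"
  then show "\<nexists>z. step (case_nat x c m) z"
    using assms(2) unfolding maximal_computation_def
    by (cases m) (auto simp flip: eSuc_enat zero_enat_def)
qed simp

text \<open>The induction is on inevitability, not on the computation, so finite and infinite
  computations are treated alike: the tail of a maximal computation is again maximal.\<close>

lemma inevitable_maximal_computation:
  assumes "inevitable step P x" and "maximal_computation step x c n"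
  shows "\<exists>i. enat i \<le> n \<and> P (c i)"
  using assms
proof (induction arbitrary: c n)
  case (now x)
  then have "enat 0 \<le> n \<and> P (c 0)"
    by (simp add: maximal_computation_def flip: zero_enat_def)
  then show ?case ..
next
  case (later x)
  have "n \<noteq> 0"
    using later.hyps(1) later.prems by (auto simp: maximal_computation_def zero_enat_def)
  with later.prems obtain m where m: "n = eSuc m" and "step x (c 1)"
    and "maximal_computation step (c 1) (\<lambda>i. c (Suc i)) m"
    by (rule maximal_computation_tail)
  then obtain i where "enat i \<le> m" "P (c (Suc i))"
    using later.IH by blast
  then show ?case
    unfolding m by (metis eSuc_enat eSuc_ile_mono)
qed

lemma inevitable_Must:
  assumes "inevitable (comp_step dual L T) (\<lambda>x. good (snd x)) (p, t)"
  shows "Must dual L T good p t"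
  unfolding Must_def using inevitable_maximal_computation[OF assms] by blast

section \<open>From \<open>Must\<close> to convergence\<close>

text \<open>Prefixing the step to a maximal computation from the successor gives one from
  \<open>(p, t)\<close>. Its first state is not good, so the good state lies in the tail.\<close>

lemma Must_step:
  assumes "Must dual L T good p t" and "\<not> good t" and "comp_step dual L T (p, t) (p', t')"
  shows "Must dual L T good p' t'"
  unfolding Must_def
proof (intro allI impI)
  fix c n assume "maximal_computation (comp_step dual L T) (p', t') c n"
  with assms(3) have "maximal_computation (comp_step dual L T) (p, t) (case_nat (p, t) c) (eSuc n)"
    by (rule maximal_computation_Cons)
  then obtain i where i: "enat i \<le> eSuc n" "good (snd (case_nat (p, t) c i))"
    using assms(1) unfolding Must_def by blast
  with assms(2) obtain j where "i = Suc j"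
    by (cases i) auto
  with i show "\<exists>i. enat i \<le> n \<and> good (snd (c i))"
    by (auto simp flip: eSuc_enat)
qed

text \<open>Letting the process diverge while the test stays idle at \<open>t\<close> is an
  infinite, hence maximal, computation.\<close>

lemma Must_not_diverges:
  assumes "Must dual L T good p t" and "\<not> good t"
  shows "\<not> diverges L p"
proof
  assume "diverges L p"
  then obtain f where "f 0 = p" "\<And>i. L (f i) Tau (f (Suc i))"
    unfolding diverges_def by blast
  then have "maximal_computation (comp_step dual L T) (p, t) (\<lambda>i. (f i, t)) \<infinity>"
    by (auto simp: maximal_computation_def intro: comp_step.proc)
  with assms show False
    unfolding Must_def by fastforce
qed

lemma Must_trace_tests_not_diverges:
  assumes "involutive dual" and "trace_tests N T good f"
    and "weak L p u q" and "prefix u s" and "Must dual L T good p (f (map dual s))"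
  shows "\<not> diverges L q"
  using assms(3-5)
proof (induction arbitrary: s)
  case (refl p)
  then show ?case
    using Must_not_diverges assms(2) unfolding trace_tests_def by metis
next
  case (tau p p' u q)
  have "Must dual L T good p' (f (map dual s))"
    using Must_step[OF tau.prems(2)] assms(2) tau.hyps(1) comp_step.proc
    unfolding trace_tests_def by metis
  then show ?case
    using tau by blast
next
  case (vis p \<mu> p' u q)
  obtain s' where s: "s = \<mu> # s'" and "prefix u s'"
    using vis.prems(1) by (cases s) auto
  have "T (f (map dual s)) (Vis (dual \<mu>)) (f (map dual s'))"
    and "\<not> good (f (map dual s))"
    using assms(2) unfolding s trace_tests_def by auto
  \<comment> \<open>\<open>comm\<close> dualises the action of the test, which here is already
    \<open>dual \<mu>\<close>.\<close>
  moreover have "L p (Vis (dual (dual \<mu>))) p'"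
    using vis.hyps(1) assms(1) by (simp add: involutive_def)
  ultimately have "Must dual L T good p' (f (map dual s'))"
    using Must_step[OF vis.prems(2)] comp_step.comm by metis
  then show ?case
    using vis.IH \<open>prefix u s'\<close> by blast
qed

section \<open>Moving a pending non-blocking action\<close>

text \<open>The point \<open>(p, t)\<close> differs from \<open>(p', t')\<close> in that the pending \<open>\<eta>\<close> is held by the test.\<close>

lemma inevitable_move_nonblocking:
  assumes "involutive dual" and M: "L \<in> class_M dual N" and A: "T \<in> class_A dual N"
    and "good_predicate N T good" and "\<eta> \<in> N"
    and "inevitable (comp_step dual L T) (\<lambda>x. good (snd x)) (p', t')"
    and "L p' (Vis \<eta>) p" and "T t (Vis \<eta>) t'"
  shows "inevitable (comp_step dual L T) (\<lambda>x. good (snd x)) (p, t)"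
  using assms(6-8)
proof (induction "(p', t')" arbitrary: p' t' p t)
  case now
  then have "good t"
    using assms(4,5) unfolding good_predicate_def by fastforce
  then show ?case
    by (simp add: inevitable.now)
next
  case (later p' t')
  note p = \<open>L p' (Vis \<eta>) p\<close> and t = \<open>T t (Vis \<eta>) t'\<close>
  let ?step = "comp_step dual L T"
  let ?I = "inevitable ?step (\<lambda>x. good (snd x))"
  have I': "?I (p', t')"
    using later.hyps(1,2) by (rule inevitable.later)
  have IH: "?I (p1, t1)" if "?step (p', t') (p2, t2)" "L p2 (Vis \<eta>) p1" "T t1 (Vis \<eta>) t2"
    for p1 t1 p2 t2
    using later.hyps(3) that by blast
  \<comment> \<open>The process still holding \<eta> can perform any move of \<open>p\<close> first
    and keep \<eta> pending.\<close>
  have delay: "\<exists>p4. L p' \<alpha> p4 \<and> L p4 (Vis \<eta>) p3" if "L p \<alpha> p3" for \<alpha> p3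
    using M \<open>\<eta> \<in> N\<close> p that unfolding class_M_def N_delay_def by blast
  show ?case
  proof (rule inevitable.later)
    \<comment> \<open>No deadlock: the process can always receive the \<eta> offered by
      \<open>t\<close>.\<close>
    obtain q where "L p (Vis (dual \<eta>)) q"
      using M \<open>\<eta> \<in> N\<close> unfolding class_M_def Boomerang_def by blast
    then show "\<exists>y. ?step (p, t) y"
      using t comp_step.comm by metis
  next
    fix y assume "?step (p, t) y"
    then show "?I y"
    proof cases
      case (proc p3)
      then show ?thesis
        using delay IH t comp_step.proc by metis
    next
      case (test t3)
      then have "(\<exists>t4. T t' Tau t4 \<and> T t3 (Vis \<eta>) t4) \<or> T t' (Vis (dual \<eta>)) t3"
        using A \<open>\<eta> \<in> N\<close> t unfolding class_A_def N_tau_def by blast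
      \<comment> \<open>Either the internal step commutes with \<eta>, or it consumes \<eta> inside
        the test. The latter is matched by \<open>p'\<close> sending \<eta> to
        \<open>t'\<close>.\<close>
      then show ?thesis
      proof
        assume "\<exists>t4. T t' Tau t4 \<and> T t3 (Vis \<eta>) t4"
        then show ?thesis
          unfolding \<open>y = _\<close> using IH p comp_step.test by metis
      next
        assume "T t' (Vis (dual \<eta>)) t3"
        moreover have "L p' (Vis (dual (dual \<eta>))) p"
          using p assms(1) by (simp add: involutive_def)
        ultimately show ?thesis
          unfolding \<open>y = _\<close> using later.hyps(2) comp_step.comm by metis
      qed
    next
      case (comm \<mu> p3 t3)
      show ?thesis
      proof (cases "\<mu> = \<eta>")
        case True
        then have "t3 = t'"
          using A \<open>\<eta> \<in> N\<close> t comm unfolding class_A_def N_determinacy_def by blast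
        \<comment> \<open>The process receives \<eta> from the test. With \<eta> on the process side
          this is feedback within the process: an internal step, or no step at all, in which case
          \<open>I'\<close> applies.\<close>
        moreover have "L p' Tau p3 \<or> p' = p3"
          using M \<open>\<eta> \<in> N\<close> p comm True unfolding class_M_def Fwd_Feedback_def by blast
        ultimately show ?thesis
          unfolding \<open>y = _\<close> using I' later.hyps(2) comp_step.proc by metis
      next
        case False
        then obtain t4 where "T t' (Vis \<mu>) t4" "T t3 (Vis \<eta>) t4"
          using A \<open>\<eta> \<in> N\<close> t comm unfolding class_A_def N_confluence_def by blast
        then show ?thesis
          unfolding \<open>y = _\<close> using delay[OF \<open>L p (Vis (dual \<mu>)) p3\<close>] IH comp_step.comm by metis
      qed
    qed
  qed
qed

section \<open>From convergence to inevitability\<close>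

lemma not_diverges_accp:
  assumes "\<not> diverges L p"
  shows "Wellfounded.accp (\<lambda>q' q. L q Tau q') p"
proof (rule ccontr)
  let ?A = "Wellfounded.accp (\<lambda>q' q. L q Tau q')"
  assume "\<not> ?A p"
  \<comment> \<open>A non-accessible state has a non-accessible internal successor; the clause for
    \<open>i = 0\<close> fixes the start of the chosen sequence.\<close>
  then have "\<exists>f. \<forall>i. (\<not> ?A (f i) \<and> (i = 0 \<longrightarrow> f i = p)) \<and> L (f i) Tau (f (Suc i))"
    by (intro dependent_nat_choice) (auto elim: not_accp_down)
  with assms show False
    unfolding diverges_def by blast
qed

lemma converges_along_not_diverges: "converges_along L p s \<Longrightarrow> \<not> diverges L p"
  unfolding converges_along_def by (meson Nil_prefix weak.refl)

lemma converges_along_Tau: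
  "converges_along L p s \<Longrightarrow> L p Tau p' \<Longrightarrow> converges_along L p' s"
  unfolding converges_along_def by (meson weak.tau)

lemma converges_along_Vis:
  "converges_along L p (\<mu> # s) \<Longrightarrow> L p (Vis \<mu>) p' \<Longrightarrow> converges_along L p' s"
  unfolding converges_along_def by (meson Cons_prefix_Cons weak.vis)

text \<open>The empty prefix of \<open>s\<close> makes internal steps well-founded at
  \<open>p\<close>, and convergence passes to internal successors.\<close>

lemma converges_along_induct [consumes 1, case_names step]:
  assumes "converges_along L p s"
    and "\<And>p. converges_along L p s \<Longrightarrow> (\<And>p'. L p Tau p' \<Longrightarrow> P p') \<Longrightarrow> P p"
  shows "P p"
  using not_diverges_accp[OF converges_along_not_diverges[OF assms(1)]] assms(1)
  by (induction rule: accp_induct_rule) (metis assms(2) converges_along_Tau)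

lemma converges_along_inevitable:
  assumes "involutive dual" and M: "L \<in> class_M dual N" and "T \<in> class_A dual N"
    and "good_predicate N T good" and f: "trace_tests N T good f"
    and Nil_Vis: "\<And>\<mu> t. \<not> T (f []) (Vis \<mu>) t"
    and Nil_Tau: "\<exists>t. T (f []) Tau t" "\<And>t. T (f []) Tau t \<Longrightarrow> good t"
    and "converges_along L p s"
  shows "inevitable (comp_step dual L T) (\<lambda>x. good (snd x)) (p, f (map dual s))"
  using assms(9)
proof (induction s arbitrary: p)
  case Nil
  then show ?case
  proof (induction rule: converges_along_induct)
    case (step p)
    show ?case
    proof (rule inevitable.later)
      show "\<exists>y. comp_step dual L T (p, f (map dual [])) y"
        using Nil_Tau(1) comp_step.test by fastforce
    next
      fix y assume "comp_step dual L T (p, f (map dual [])) y"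
      then show "inevitable (comp_step dual L T) (\<lambda>x. good (snd x)) y"
        using step.IH Nil_Vis Nil_Tau(2) by cases (auto intro: inevitable.now)
    qed
  qed
next
  case (Cons \<mu> s)
  have dd: "dual (dual \<mu>) = \<mu>"
    using assms(1) by (simp add: involutive_def)
  have f_step: "T (f (map dual (\<mu> # s))) (Vis (dual \<mu>)) (f (map dual s))"
    using f unfolding trace_tests_def by simp
  show ?case
  proof (cases "dual \<mu> \<in> N")
    case True
    \<comment> \<open>Boomerang for \<open>dual \<mu>\<close>: since \<open>p\<close> reaches
      \<open>p'\<close> by \<mu>, the state \<open>p'\<close> converges along the rest of the trace,
      and moving the pending \<open>dual \<mu>\<close> to the test leads back to
      \<open>p\<close>.\<close>
    then obtain p' where "L p (Vis \<mu>) p'" "L p' (Vis (dual \<mu>)) p"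
      using M dd unfolding class_M_def Boomerang_def by fastforce
    moreover from this have "inevitable (comp_step dual L T) (\<lambda>x. good (snd x)) (p', f (map dual s))"
      using Cons converges_along_Vis by metis
    ultimately show ?thesis
      using inevitable_move_nonblocking[OF assms(1-4) True] f_step by blast
  next
    case False
    let ?t = "f (map dual (\<mu> # s))"
    have Tau: "\<exists>t. T ?t Tau t" "\<And>t. T ?t Tau t \<Longrightarrow> good t"
      and Vis: "\<And>t. T ?t (Vis (dual \<mu>)) t \<Longrightarrow> t = f (map dual s)"
        "\<And>\<mu>' t. T ?t (Vis \<mu>') t \<Longrightarrow> \<mu>' \<noteq> dual \<mu> \<Longrightarrow> good t"
      using f False unfolding trace_tests_def by auto
    \<comment> \<open>The inner induction handles internal steps of the process, during which the
      test does not change.\<close>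
    from Cons.prems show ?thesis
    proof (induction rule: converges_along_induct)
      case (step p)
      show ?case
      proof (rule inevitable.later)
        show "\<exists>y. comp_step dual L T (p, ?t) y"
          using Tau(1) comp_step.test by metis
      next
        fix y assume "comp_step dual L T (p, ?t) y"
        then show "inevitable (comp_step dual L T) (\<lambda>x. good (snd x)) y"
        proof cases
          case (proc p')
          then show ?thesis
            using step.IH by blast
        next
          case (test t')
          then show ?thesis
            using Tau(2) by (auto intro: inevitable.now)
        next
          case (comm \<mu>' p' t')
          show ?thesis
          proof (cases "\<mu>' = dual \<mu>")
            case True
            then have "t' = f (map dual s)" "L p (Vis \<mu>) p'"
              using comm Vis(1) dd by auto
            then show ?thesis
              using comm(1) Cons.IH converges_along_Vis[OF step.hyps] by blast
          next
            case False
            then show ?thesis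
              using comm Vis(2) by (auto intro: inevitable.now)
          qed
        qed
      qed
    qed
  qed
qed

theorem lemma22:
  fixes dual :: "'a::countable \<Rightarrow> 'a"
    and N :: "'a set"
    and L :: "('p, 'a) lts"
    and T :: "('t, 'a) lts"
    and good :: "'t \<Rightarrow> bool"
    and Y :: "'y set"
    and X :: "'x set"
    and \<phi> :: "'a \<Rightarrow> 'y"
    and \<delta> :: "'y \<Rightarrow> 'x"
    and t_cnv :: "'a list \<Rightarrow> 't"
    and t_acc :: "'a list \<Rightarrow> 'x set \<Rightarrow> 't"
    and s :: "'a list"
    and p :: 'p
  assumes "involutive dual"
    and "L \<in> class_M dual N"
    and "T \<in> class_A dual N"
    and "good_predicate N T good"
    and "label_abstraction N Y X \<phi> \<delta>"
    and "abstracts dual N \<phi> \<delta> L T"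
    and "AxCmpl_witness N T good X \<phi> \<delta> t_cnv t_acc"
  shows "Must dual L T good p (t_cnv (map dual s)) \<longleftrightarrow> converges_along L p s"
proof
  have f: "trace_tests N T good t_cnv"
    using assms(7) unfolding AxCmpl_witness_def by blast
  show "converges_along L p s" if "Must dual L T good p (t_cnv (map dual s))"
    unfolding converges_along_def
    using Must_trace_tests_not_diverges[OF assms(1) f _ _ that] by blast
  show "Must dual L T good p (t_cnv (map dual s))" if "converges_along L p s"
  proof (rule inevitable_Must, rule converges_along_inevitable[OF assms(1-4) f _ _ _ that])
    show "\<not> T (t_cnv []) (Vis \<mu>) t" for \<mu> t
      using assms(7) unfolding AxCmpl_witness_def by blast
    show "\<exists>t. T (t_cnv []) Tau t"
      using assms(7) unfolding AxCmpl_witness_def by blast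
    show "good t" if "T (t_cnv []) Tau t" for t
      using assms(7) that unfolding AxCmpl_witness_def by blast
  qed
qed

end
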